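(* Let $e$ be a regular expression over a finite alphabet $\Sigma$, let $\pi$ be a heap and $p$ an address with $\pi,p\models e$, with continuation function $\mathrm{cont}$ satisfying $\pi\models\mathrm{cont}$ (root $p$). Then for every string $w\in\Sigma^*$, there is a run of the PW$\pi$ machine \[ \langle p\,;\,w\rangle\to^{*}\langle\mathrm{null}\,;\,\epsilon_{\mathrm{str}}\rangle \] if and only if there is a finite run of the generic lockstep machine \[ \langle \{p\}\,;\,w\rangle \Rightarrow \cdots \Rightarrow \langle S\,;\,\epsilon_{\mathrm{str}}\rangle \] for some set of addresses $S$ with $\mathrm{null}\in S$.
   Context: Regular expressions over $\Sigma$: $e ::= \varepsilon \mid a \mid e^{*} \mid e_1e_2 \mid e_1\mid e_2$ ($a\in\Sigma$); $\varepsilon$ is a constant and $\epsilon_{\mathrm{str}}$ denotes the empty string. Heaps: a heap $\pi$ is a finite partial function from addresses to nodes; there is a distinguished address $\mathrm{null}$ not in its domain. A node is one of $a$ ($a\in\Sigma$), $\varepsilon$, $(p_1\mid p_2)$, $(p_1\bullet p_2)$, $(p_1)^{*}$ for addresses $p_1,p_2$. For partial functions with disjoint domains, $f_1\otimes f_2=f_1\cup f_2$. The relation $\pi,p\models e$ is defined by induction on $e$: $\pi,p\models a$ iff $\pi(p)=a$; $\pi,p\models\varepsilon$ iff $\pi(p)=\varepsilon$ (in these cases $\pi$ consists of the single cell at $p$); $\pi,p\models(e_1\mid e_2)$ iff $\pi=\pi_0\otimes\pi_1\otimes\pi_2$, $\pi_0(p)=(p_1\mid p_2)$, $\pi_1,p_1\models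 e_1$, $\pi_2,p_2\models e_2$; $\pi,p\models(e_1e_2)$ iff $\pi=\pi_0\otimes\pi_1\otimes\pi_2$, $\pi_0(p)=(p_1\bullet p_2)$, $\pi_1,p_1\models e_1$, $\pi_2,p_2\models e_2$; $\pi,p\models e_1^{*}$ iff $\pi=\pi_0\otimes\pi_1$, $\pi_0(p)=(p_1)^{*}$, $\pi_1,p_1\models e_1$. Continuation function: $\mathrm{cont}:\mathrm{dom}(\pi)\to\mathrm{dom}(\pi)\cup\{\mathrm{null}\}$ with $\pi\models\mathrm{cont}$ meaning: if $\pi(q)=(q_1\mid q_2)$ then $\mathrm{cont}(q_1)=\mathrm{cont}(q_2)=\mathrm{cont}(q)$; if $\pi(q)=(q_1\bullet q_2)$ then $\mathrm{cont}(q_1)=q_2$, $\mathrm{cont}(q_2)=\mathrm{cont}(q)$; if $\pi(q)=(q_1)^{*}$ then $\mathrm{cont}(q_1)=q$; and $\mathrm{cont}$ of the root is $\mathrm{null}$. Pointer steps relative to $\pi$: $q\to q_1$ and $q\to q_2$ if $\pi(q)=q_1\mid q_2$; $q\to q_1$ if $\pi(q)=q_1\bullet q_2$; $q\to q_1$ and $q\to\mathrm{cont}(q)$ if $\pi(q)=(q_1)^{*}$; $q\to\mathrm{cont}(q)$ if $\pi(q)=\varepsilon$; $q\xrightarrow{a}\mathrm{cont}(q)$ if $\pi(q)=a$. ($\mathrm{null}$ has no steps.) The PW$\pi$ machine has configurations $\langle q;w\rangle$ and transitions $\langle q;a\,w\rangle\to\langle q';w\rangle$ if $q\xrightarrow{a}q'$,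 and $\langle q;w\rangle\to\langle q';w\rangle$ if $q\to q'$; $\to^*$ is zero or more transitions. Evolution: for $S\subseteq\mathrm{dom}(\pi)\cup\{\mathrm{null}\}$, $\mathrm{evolve}(S)=\{q\in\mathrm{dom}(\pi)\cup\{\mathrm{null}\}\mid \exists p'\in S.\ p'\to^{*}q \text{ and } (q=\mathrm{null} \text{ or } \exists a.\ \pi(q)=a)\}$, where $\to^*$ is the reflexive–transitive closure of the unlabeled pointer step. Lockstep transitions on sets: $S\Rightarrow S'$ if $S'=\mathrm{evolve}(S)$; $S\xRightarrow{a}S'$ if $S'=\{q\in\mathrm{dom}(\pi)\cup\{\mathrm{null}\}\mid\exists p'\in S.\ p'\xrightarrow{a}q\}$. The generic lockstep machine has configurations $\langle S;w\rangle$ and transitions $\langle S;a\,w\rangle\Rightarrow\langle S';w\rangle$ if $S\xRightarrow{a}S'$, and $\langle S;w\rangle\Rightarrow\langle S';w\rangle$ if $S\Rightarrow S'$. *)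

theory Defs
  imports Main
begin

datatype (letters: 'a) regexp =
    Eps
  | Chr 'a
  | Star "'a regexp"
  | Seq "'a regexp" "'a regexp"
  | Alt "'a regexp" "'a regexp"

datatype (node_letters: 'a, node_addrs: 'p) node =
    NChr 'a
  | NEps
  | NAlt 'p 'p
  | NSeq 'p 'p
  | NStar 'p

type_synonym ('a, 'p) heap = "'p \<rightharpoonup> ('a, 'p) node"

definition is_heap :: "'a set \<Rightarrow> 'p \<Rightarrow> ('a, 'p) heap \<Rightarrow> bool" where
  "is_heap \<Sigma> null \<pi> \<longleftrightarrow>
     finite (dom \<pi>) \<and> null \<notin> dom \<pi> \<and> (\<forall>n\<in>ran \<pi>. node_letters n \<subseteq> \<Sigma>)"

text \<open>The partial operation \<open>f\<^sub>1 \<otimes> f\<^sub>2\<close> is rendered as \<^term>\<open>f\<^sub>1 ++ f\<^sub>2\<close>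
  together with the side condition that the domains are disjoint.\<close>

definition orth :: "('p \<rightharpoonup> 'b) \<Rightarrow> ('p \<rightharpoonup> 'b) \<Rightarrow> bool" where
  "orth f g \<longleftrightarrow> dom f \<inter> dom g = {}"

text \<open>In the composite cases \<open>\<pi>\<^sub>0\<close> is only required to hold the right node at \<open>p\<close>;
  it may contain further cells.\<close>

fun models :: "('a, 'p) heap \<Rightarrow> 'p \<Rightarrow> 'a regexp \<Rightarrow> bool" where
  "models \<pi> p (Chr a) \<longleftrightarrow> \<pi> = [p \<mapsto> NChr a]"
| "models \<pi> p Eps \<longleftrightarrow> \<pi> = [p \<mapsto> NEps]"
| "models \<pi> p (Alt e1 e2) \<longleftrightarrow>
     (\<exists>\<pi>0 \<pi>1 \<pi>2 p1 p2. orth \<pi>0 \<pi>1 \<and> orth (\<pi>0 ++ \<pi>1) \<pi>2 \<and> \<pi> = \<pi>0 ++ \<pi>1 ++ \<pi>2 \<and>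
        \<pi>0 p = Some (NAlt p1 p2) \<and> models \<pi>1 p1 e1 \<and> models \<pi>2 p2 e2)"
| "models \<pi> p (Seq e1 e2) \<longleftrightarrow>
     (\<exists>\<pi>0 \<pi>1 \<pi>2 p1 p2. orth \<pi>0 \<pi>1 \<and> orth (\<pi>0 ++ \<pi>1) \<pi>2 \<and> \<pi> = \<pi>0 ++ \<pi>1 ++ \<pi>2 \<and>
        \<pi>0 p = Some (NSeq p1 p2) \<and> models \<pi>1 p1 e1 \<and> models \<pi>2 p2 e2)"
| "models \<pi> p (Star e1) \<longleftrightarrow>
     (\<exists>\<pi>0 \<pi>1 p1. orth \<pi>0 \<pi>1 \<and> \<pi> = \<pi>0 ++ \<pi>1 \<and>
        \<pi>0 p = Some (NStar p1) \<and> models \<pi>1 p1 e1)"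

text \<open>Continuation functions are total in HOL; only their values on \<^term>\<open>dom \<pi>\<close> are used
  by the steps below. The address \<open>p\<close> is the root.\<close>

definition models_cont ::
  "'p \<Rightarrow> ('a, 'p) heap \<Rightarrow> 'p \<Rightarrow> ('p \<Rightarrow> 'p) \<Rightarrow> bool" where
  "models_cont null \<pi> p cont \<longleftrightarrow>
     (\<forall>q\<in>dom \<pi>. cont q \<in> dom \<pi> \<union> {null}) \<and>
     (\<forall>q q1 q2. \<pi> q = Some (NAlt q1 q2) \<longrightarrow> cont q1 = cont q \<and> cont q2 = cont q) \<and>
     (\<forall>q q1 q2. \<pi> q = Some (NSeq q1 q2) \<longrightarrow> cont q1 = q2 \<and> cont q2 = cont q) \<and>
     (\<forall>q q1. \<pi> q = Some (NStar q1) \<longrightarrow> cont q1 = q) \<and>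
     cont p = null"

inductive eps_step :: "('a, 'p) heap \<Rightarrow> ('p \<Rightarrow> 'p) \<Rightarrow> 'p \<Rightarrow> 'p \<Rightarrow> bool"
  for \<pi> :: "('a, 'p) heap" and cont :: "'p \<Rightarrow> 'p" where
  alt_left: "\<pi> q = Some (NAlt q1 q2) \<Longrightarrow> eps_step \<pi> cont q q1"
| alt_right: "\<pi> q = Some (NAlt q1 q2) \<Longrightarrow> eps_step \<pi> cont q q2"
| seq: "\<pi> q = Some (NSeq q1 q2) \<Longrightarrow> eps_step \<pi> cont q q1"
| star_body: "\<pi> q = Some (NStar q1) \<Longrightarrow> eps_step \<pi> cont q q1"
| star_exit: "\<pi> q = Some (NStar q1) \<Longrightarrow> eps_step \<pi> cont q (cont q)"
| eps: "\<pi> q = Some NEps \<Longrightarrow> eps_step \<pi> cont q (cont q)"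

inductive chr_step :: "('a, 'p) heap \<Rightarrow> ('p \<Rightarrow> 'p) \<Rightarrow> 'a \<Rightarrow> 'p \<Rightarrow> 'p \<Rightarrow> bool"
  for \<pi> :: "('a, 'p) heap" and cont :: "'p \<Rightarrow> 'p" where
  chr: "\<pi> q = Some (NChr a) \<Longrightarrow> chr_step \<pi> cont a q (cont q)"

inductive pw_step ::
  "('a, 'p) heap \<Rightarrow> ('p \<Rightarrow> 'p) \<Rightarrow> 'p \<times> 'a list \<Rightarrow> 'p \<times> 'a list \<Rightarrow> bool"
  for \<pi> :: "('a, 'p) heap" and cont :: "'p \<Rightarrow> 'p" where
  pw_chr: "chr_step \<pi> cont a q q' \<Longrightarrow> pw_step \<pi> cont (q, a # w) (q', w)"
| pw_eps: "eps_step \<pi> cont q q' \<Longrightarrow> pw_step \<pi> cont (q, w) (q', w)"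

definition evolve :: "'p \<Rightarrow> ('a, 'p) heap \<Rightarrow> ('p \<Rightarrow> 'p) \<Rightarrow> 'p set \<Rightarrow> 'p set" where
  "evolve null \<pi> cont S =
     {q \<in> dom \<pi> \<union> {null}.
        \<exists>p'\<in>S. (eps_step \<pi> cont)\<^sup>*\<^sup>* p' q \<and> (q = null \<or> (\<exists>a. \<pi> q = Some (NChr a)))}"

definition chr_image :: "'p \<Rightarrow> ('a, 'p) heap \<Rightarrow> ('p \<Rightarrow> 'p) \<Rightarrow> 'a \<Rightarrow> 'p set \<Rightarrow> 'p set" where
  "chr_image null \<pi> cont a S = {q \<in> dom \<pi> \<union> {null}. \<exists>p'\<in>S. chr_step \<pi> cont a p' q}"

inductive lockstep ::
  "'p \<Rightarrow> ('a, 'p) heap \<Rightarrow> ('p \<Rightarrow> 'p) \<Rightarrow> 'p set \<times> 'a list \<Rightarrow> 'p set \<times> 'a list \<Rightarrow> bool"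
  for null :: 'p and \<pi> :: "('a, 'p) heap" and cont :: "'p \<Rightarrow> 'p" where
  lock_chr: "S' = chr_image null \<pi> cont a S \<Longrightarrow> lockstep null \<pi> cont (S, a # w) (S', w)"
| lock_eps: "S' = evolve null \<pi> cont S \<Longrightarrow> lockstep null \<pi> cont (S, w) (S', w)"

end

theory Submission
  imports Defs
begin

text \<open>Every address in a lockstep set is reached by an individual run of the PW machine. Conversely,
  a lockstep run follows a PW run with a delay: it leaves the unlabeled steps pending until the next
  letter is read, and then performs them in a single evolution. No address needed later is lost,
  since the PW machine reads a letter only at a letter node, and evolutions keep letter nodes.\<close>

definition cont_closed :: "'p \<Rightarrow> ('a, 'p) heap \<Rightarrow> ('p \<Rightarrow> 'p) \<Rightarrow> bool" where
  "cont_closed null \<pi> cont \<longleftrightarrow> (\<forall>q\<in>dom \<pi>. cont q \<in> dom \<pi> \<union> {null})"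

definition resting :: "'p \<Rightarrow> ('a, 'p) heap \<Rightarrow> 'p \<Rightarrow> bool" where
  "resting null \<pi> q \<longleftrightarrow> q = null \<or> (\<exists>a. \<pi> q = Some (NChr a))"

lemma resting_null: "resting null \<pi> null"
  by (simp add: resting_def)

lemma chr_step_imp_resting: "chr_step \<pi> cont a q q' \<Longrightarrow> resting null \<pi> q"
  by (auto simp: chr_step.simps resting_def)

lemma models_cont_imp_cont_closed: "models_cont null \<pi> p cont \<Longrightarrow> cont_closed null \<pi> cont"
  by (simp add: models_cont_def cont_closed_def)

lemma mem_evolve_iff:
  "q \<in> evolve null \<pi> cont S \<longleftrightarrow> resting null \<pi> q \<and> (\<exists>s\<in>S. (eps_step \<pi> cont)\<^sup>*\<^sup>* s q)"
  by (auto simp: evolve_def resting_def)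

lemma mem_chr_image_iff:
  assumes "cont_closed null \<pi> cont"
  shows "q \<in> chr_image null \<pi> cont a S \<longleftrightarrow> (\<exists>s\<in>S. chr_step \<pi> cont a s q)"
  using assms by (auto simp: chr_image_def cont_closed_def chr_step.simps)

lemma eps_steps_imp_pw_steps:
  assumes "(eps_step \<pi> cont)\<^sup>*\<^sup>* q q'"
  shows "(pw_step \<pi> cont)\<^sup>*\<^sup>* (q, w) (q', w)"
  using assms by induction (auto intro: pw_eps rtranclp.rtrancl_into_rtrancl)

lemma lockstep_imp_pw_steps:
  assumes "lockstep null \<pi> cont (S, w) (S', w')" and "q' \<in> S'"
  shows "\<exists>q\<in>S. (pw_step \<pi> cont)\<^sup>*\<^sup>* (q, w) (q', w')"
  using assms(1)
proof cases
  case (lock_chr a)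
  with assms(2) show ?thesis
    by (auto simp: chr_image_def dest!: pw_chr)
next
  case lock_eps
  with assms(2) show ?thesis
    by (auto simp: mem_evolve_iff intro: eps_steps_imp_pw_steps)
qed

lemma lockstep_run_imp_pw_run:
  assumes "(lockstep null \<pi> cont)\<^sup>*\<^sup>* (S, w) (S', w')" and "q' \<in> S'"
  shows "\<exists>q\<in>S. (pw_step \<pi> cont)\<^sup>*\<^sup>* (q, w) (q', w')"
  using assms
proof (induction arbitrary: q' rule: rtranclp_induct2)
  case refl
  then show ?case by blast
next
  case (step T v T' v')
  obtain r where "r \<in> T" and last_steps: "(pw_step \<pi> cont)\<^sup>*\<^sup>* (r, v) (q', v')"
    using lockstep_imp_pw_steps[OF step.hyps(2) step.prems] by blast
  obtain q where "q \<in> S" and "(pw_step \<pi> cont)\<^sup>*\<^sup>* (q, w) (r, v)"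
    using step.IH[OF \<open>r \<in> T\<close>] by blast
  then show ?case
    using last_steps by (blast intro: rtranclp_trans)
qed

lemma lockstep_evolve_then_chr:
  "(lockstep null \<pi> cont)\<^sup>*\<^sup>* (S, a # w) (chr_image null \<pi> cont a (evolve null \<pi> cont S), w)"
proof -
  have "lockstep null \<pi> cont (S, a # w) (evolve null \<pi> cont S, a # w)"
    by (rule lock_eps[OF refl])
  moreover have "lockstep null \<pi> cont (evolve null \<pi> cont S, a # w)
      (chr_image null \<pi> cont a (evolve null \<pi> cont S), w)"
    by (rule lock_chr[OF refl])
  ultimately show ?thesis by (rule rtranclp.rtrancl_into_rtrancl[OF r_into_rtranclp])
qed

lemma pw_run_imp_lockstep_run_upto_eps:
  assumes closed_cont: "cont_closed null \<pi> cont"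
    and "(pw_step \<pi> cont)\<^sup>*\<^sup>* (q, w) (q', w')" and "q \<in> S"
  shows "\<exists>S' s. (lockstep null \<pi> cont)\<^sup>*\<^sup>* (S, w) (S', w') \<and> s \<in> S' \<and> (eps_step \<pi> cont)\<^sup>*\<^sup>* s q'"
  using assms(2)
proof (induction rule: rtranclp_induct2)
  case refl
  then show ?case using \<open>q \<in> S\<close> by blast
next
  case (step r v r' v')
  obtain T s where run: "(lockstep null \<pi> cont)\<^sup>*\<^sup>* (S, w) (T, v)"
    and pending: "s \<in> T" "(eps_step \<pi> cont)\<^sup>*\<^sup>* s r"
    using step.IH by blast
  from step.hyps(2) show ?case
  proof cases
    case (pw_chr a)
    let ?T' = "chr_image null \<pi> cont a (evolve null \<pi> cont T)"
    have "r \<in> evolve null \<pi> cont T"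
      unfolding mem_evolve_iff using pending chr_step_imp_resting[OF pw_chr(2)] by blast
    then have "r' \<in> ?T'"
      unfolding mem_chr_image_iff[OF closed_cont] using pw_chr(2) by blast
    moreover have "(lockstep null \<pi> cont)\<^sup>*\<^sup>* (S, w) (?T', v')"
      using run lockstep_evolve_then_chr unfolding pw_chr(1) by (rule rtranclp_trans)
    ultimately show ?thesis by blast
  next
    case pw_eps
    then have "(eps_step \<pi> cont)\<^sup>*\<^sup>* s r'"
      using pending(2) by simp
    with run pending(1) pw_eps(1) show ?thesis by blast
  qed
qed

lemma pw_run_imp_lockstep_run:
  assumes "cont_closed null \<pi> cont"
    and "(pw_step \<pi> cont)\<^sup>*\<^sup>* (q, w) (q', w')" and "q \<in> S" and "resting null \<pi> q'"
  shows "\<exists>S'. (lockstep null \<pi> cont)\<^sup>*\<^sup>* (S, w) (S', w') \<and> q' \<in> S'"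
proof -
  obtain T s where run: "(lockstep null \<pi> cont)\<^sup>*\<^sup>* (S, w) (T, w')"
    and pending: "s \<in> T" "(eps_step \<pi> cont)\<^sup>*\<^sup>* s q'"
    using pw_run_imp_lockstep_run_upto_eps[OF assms(1-3)] by blast
  have "(lockstep null \<pi> cont)\<^sup>*\<^sup>* (S, w) (evolve null \<pi> cont T, w')"
    using run lock_eps[OF refl] by (rule rtranclp.rtrancl_into_rtrancl)
  moreover have "q' \<in> evolve null \<pi> cont T"
    unfolding mem_evolve_iff using pending \<open>resting null \<pi> q'\<close> by blast
  ultimately show ?thesis by blast
qed

theorem pw_run_iff_lockstep_run:
  assumes "cont_closed null \<pi> cont" and "resting null \<pi> q'"
  shows "(\<exists>q\<in>S. (pw_step \<pi> cont)\<^sup>*\<^sup>* (q, w) (q', w')) \<longleftrightarrow>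
    (\<exists>S'. (lockstep null \<pi> cont)\<^sup>*\<^sup>* (S, w) (S', w') \<and> q' \<in> S')"
  using pw_run_imp_lockstep_run[OF assms(1) _ _ assms(2)] lockstep_run_imp_pw_run by metis

theorem theorem3:
  fixes \<Sigma> :: "'a set" and e :: "'a regexp" and null p :: 'p
    and \<pi> :: "('a, 'p) heap" and cont :: "'p \<Rightarrow> 'p" and w :: "'a list"
  assumes "finite \<Sigma>"
    and "letters e \<subseteq> \<Sigma>"
    and "is_heap \<Sigma> null \<pi>"
    and "models \<pi> p e"
    and "models_cont null \<pi> p cont"
    and "w \<in> lists \<Sigma>"
  shows "(pw_step \<pi> cont)\<^sup>*\<^sup>* (p, w) (null, []) \<longleftrightarrow>
         (\<exists>S. (lockstep null \<pi> cont)\<^sup>*\<^sup>* ({p}, w) (S, []) \<and> null \<in> S)"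
proof -
  have "cont_closed null \<pi> cont"
    using \<open>models_cont null \<pi> p cont\<close> by (rule models_cont_imp_cont_closed)
  from pw_run_iff_lockstep_run[OF this resting_null, where S = "{p}"] show ?thesis
    by simp
qed

end
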